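(* Let $n\ge 2$ be an integer and let $\mathbf{A}_n$ be the valuation matrix of $n$. If $\operatorname{rank}(\mathbf{A}_n)=n-1$ (rank over $\mathbb{Q}$), then $\binom{x}{n}$ is absolutely irreducible in $\operatorname{Int}(\mathbb{Z})$.
   Context: $\operatorname{Int}(\mathbb{Z})=\{f\in\mathbb{Q}[x]\mid f(\mathbb{Z})\subseteq\mathbb{Z}\}$ and $\binom{x}{n}=\frac{x(x-1)\cdots(x-n+1)}{n!}$. An irreducible element $b$ of an integral domain $D$ is absolutely irreducible if, for every integer $m\ge 1$, $b^m$ factors uniquely into irreducible elements of $D$ (up to order and units). For a prime $p$, $\mathbf{v}_p$ denotes the $p$-adic valuation on $\mathbb{Q}$. For $n\in\mathbb{N}$ let $\mathcal{P}_n$ be the set of prime numbers $p\le n$. For $p\in\mathcal{P}_n$ let $r_{n,p}$ be the integer with $0\le r_{n,p}<p$ and $n\equiv r_{n,p}\bmod p$, and let $$\mathcal{R}_{n,p}=\begin{cases}\{1,2\} & \text{if } n=2^s\text{ with } s>1 \text{ and } p=2,\\ \{1,2,3,4\} & \text{if } n=9\text{ and } p=3,\\ \{r\in\mathbb{Z}\mid 1\le r\le p-r_{n,p}-1\} & \text{otherwise.}\end{cases}$$ For $n\ge 2$ the valuation matrix $\mathbf{A}_n$ of $n$ is the integer matrix whose rows are indexed by the pairs $(p,r)$ with $p\in\mathcal{P}_n$, $r\in\mathcal{R}_{n,p}$ (in some fixed order), whose columns are indexed by $0\le j\le n-1$, and whose entry in row $(p,r)$ and column $j$ is $\mathbf{v}_p(n+r-j)-\mathbf{v}_p(n-j)$.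 *)

theory Defs
  imports
    "HOL-Algebra.Ring_Divisibility"
    "HOL-Computational_Algebra.Computational_Algebra"
    "Jordan_Normal_Form.DL_Rank"
begin

section \<open>The ring of integer-valued polynomials\<close>

definition Int_valued :: "rat poly ring" where
  "Int_valued = \<lparr>carrier = {f. \<forall>k::int. poly f (of_int k) \<in> \<int>},
     monoid.mult = (*), one = 1, zero = 0, add = (+)\<rparr>"

definition binomial_poly :: "nat \<Rightarrow> rat poly" where
  "binomial_poly n = smult (1 / fact n) (\<Prod>i<n. [:- of_nat i, 1:])"

lemma domain_Int_valued: "domain Int_valued"
proof -
  have "cring Int_valued"
  proof (rule cringI)
    show "abelian_group Int_valued"
    proof (rule abelian_groupI)
      fix f assume f: "f \<in> carrier Int_valued"
      show "\<exists>g\<in>carrier Int_valued. g \<oplus>\<^bsub>Int_valued\<^esub> f = \<zero>\<^bsub>Int_valued\<^esub>"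
        by (rule bexI[of _ "- f"]) (use f in \<open>auto simp: Int_valued_def\<close>)
    qed (auto simp: Int_valued_def)
    show "comm_monoid Int_valued"
      by (rule comm_monoidI) (auto simp: Int_valued_def mult.assoc mult.commute)
  qed (auto simp: Int_valued_def distrib_right)
  then show ?thesis
    by (rule domainI) (auto simp: Int_valued_def)
qed


section \<open>Absolute irreducibility\<close>

text \<open>
  Intended for integral domains \<open>D\<close>. There a power of a nonzero element is nonzero, so the lists
  below consist of nonzero irreducible elements.
\<close>

definition factors_uniquely :: "('a, 'b) ring_scheme \<Rightarrow> 'a \<Rightarrow> bool" where
  "factors_uniquely D a \<longleftrightarrow>
     (\<exists>fs. set fs \<subseteq> carrier D \<and> factors D fs a) \<and>
     (\<forall>fs gs. set fs \<subseteq> carrier D \<longrightarrow> set gs \<subseteq> carrier D \<longrightarrow>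
        factors D fs a \<longrightarrow> factors D gs a \<longrightarrow> essentially_equal D fs gs)"

definition absolutely_irreducible :: "('a, 'b) ring_scheme \<Rightarrow> 'a \<Rightarrow> bool" where
  "absolutely_irreducible D b \<longleftrightarrow>
     b \<in> carrier D \<and> ring_irreducible\<^bsub>D\<^esub> b \<and>
     (\<forall>m::nat. m \<ge> 1 \<longrightarrow> factors_uniquely D (b [^]\<^bsub>D\<^esub> m))"


section \<open>The valuation matrix\<close>

definition primes_upto :: "nat \<Rightarrow> nat set" where
  "primes_upto n = {p. Factorial_Ring.prime p \<and> p \<le> n}"

text \<open>The subtraction in the last case does not truncate, since \<open>n mod p < p\<close>.\<close>

definition row_offsets :: "nat \<Rightarrow> nat \<Rightarrow> nat set" where
  "row_offsets n p =
     (if (\<exists>s>1. n = 2 ^ s) \<and> p = 2 then {1, 2}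
      else if n = 9 \<and> p = 3 then {1, 2, 3, 4}
      else {r. 1 \<le> r \<and> r \<le> p - n mod p - 1})"

text \<open>The fixed order of the rows is the lexicographic one.\<close>

definition row_indices :: "nat \<Rightarrow> (nat \<times> nat) list" where
  "row_indices n = concat (map (\<lambda>p. map (Pair p) (sorted_list_of_set (row_offsets n p)))
     (sorted_list_of_set (primes_upto n)))"

text \<open>Since \<open>j < n\<close>, both valuations are taken at positive integers and no subtraction of
  naturals truncates.\<close>

definition valuation_matrix :: "nat \<Rightarrow> int mat" where
  "valuation_matrix n = mat (length (row_indices n)) n
     (\<lambda>(i, j). case row_indices n ! i of
        (p, r) \<Rightarrow> int (multiplicity p (n + r - j)) - int (multiplicity p (n - j)))"

definition rank_over_rat :: "int mat \<Rightarrow> nat" where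
  "rank_over_rat A = vec_space.rank (dim_row A) (map_mat rat_of_int A)"

lemma set_row_indices: "set (row_indices n) = (SIGMA p:primes_upto n. row_offsets n p)"
proof -
  have "finite (primes_upto n)"
    by (rule finite_subset[of _ "{..n}"]) (auto simp: primes_upto_def)
  moreover have "finite (row_offsets n p)" for p
  proof -
    have "finite {r. 1 \<le> r \<and> r \<le> p - n mod p - 1}"
      by (rule finite_subset[of _ "{..p}"]) auto
    then show ?thesis by (simp add: row_offsets_def)
  qed
  ultimately show ?thesis by (auto simp: row_indices_def)
qed

end

theory Submission
  imports Defs
begin

text \<open>
  A divisor \<open>g\<close> of a power of the binomial polynomial has the form \<open>d \<Prod>\<^sub>j (x - j)\<^bsup>a j\<^esup>\<close> with
  \<open>j < n\<close>. Since \<open>n choose n = 1\<close>, its value at \<open>n\<close> is \<open>\<plusminus>1\<close>. For every row \<open>(p, r)\<close>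
  of the valuation matrix, \<open>p\<close> does not divide \<open>n + r choose n\<close>, hence not \<open>g(n + r)\<close> either, and
  comparing the \<open>p\<close>-adic valuations of \<open>g(n + r)\<close> and \<open>g(n)\<close> shows that the vector \<open>a\<close> is orthogonal
  to the row. The case of the binomial polynomial itself gives the same for the all-ones vector. A matrix
  of rank \<open>n - 1\<close> with \<open>n\<close> columns has a kernel of dimension one, so \<open>a\<close> is constant and \<open>g\<close> is a
  power of the binomial polynomial up to sign.
\<close>

section \<open>Matrices with a large kernel\<close>

context vec_space
begin

text \<open>The column space is a subspace of \<open>span T\<close>, and a space generated by
  \<open>T\<close> has dimension at most \<open>card T\<close>.\<close>

lemma rank_le_card_spanning:
  assumes A: "A \<in> carrier_mat n nc"
    and T: "T \<subseteq> carrier_vec n" "finite T"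
    and sub: "set (cols A) \<subseteq> span T"
  shows "rank A \<le> card T"
proof -
  have colsA: "set (cols A) \<subseteq> carrier_vec n"
    using A cols_dim by blast
  have sp: "subspace class_ring (span T) V" "subspace class_ring (span (set (cols A))) V"
    using T colsA by (auto intro!: span_is_subspace)
  have vs: "vectorspace class_ring (vs (span T))"
    using sp(1) by (rule subspace_is_vs)
  have le: "span (set (cols A)) \<subseteq> span T"
    using T sub by (intro span_subsetI)
  have own: "T \<subseteq> span T"
    using T by (intro in_own_span) auto
  \<comment> \<open>The dimension bound concerns \<open>span T\<close> as a vector space of its own,
    so \<open>T\<close> has to generate it there as well as in the ambient space.\<close>
  have gen: "LinearCombinations.module.span class_ring (vs (span T)) T = carrier (vs (span T))"
    using span_li_not_depend(1)[OF own] sp(1) by (simp add: subspace_def)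
  have fd: "vectorspace.fin_dim class_ring (vs (span T))"
    using T by (intro fin_dim_span) auto
  have fd': "vectorspace.fin_dim class_ring (span_vs (set (cols A)))"
    using A by (rule fin_dim_span_cols)
  have "rank A \<le> vectorspace.dim class_ring (vs (span T))"
    unfolding rank_def
    using vectorspace.subspace_dim[OF vs nested_subspaces[OF sp le] fd] fd' by auto
  also have "\<dots> \<le> card T"
    using vectorspace.gen_ge_dim[OF vs T(2) _ gen] own by auto
  finally show ?thesis .
qed

text \<open>Indexing the combination by \<open>K\<close> instead of by a set of vectors lets equal
  columns at different indices keep separate coefficients.\<close>

lemma linear_combination_in_span:
  fixes f :: "'b \<Rightarrow> 'a vec"
  assumes "finite K" "T \<subseteq> carrier_vec n" "\<And>k. k \<in> K \<Longrightarrow> f k \<in> span T"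
  shows "vec n (\<lambda>i. \<Sum>k\<in>K. c k * f k $ i) \<in> span T"
  using assms
proof (induction K rule: finite_induct)
  case empty
  have "vec n (\<lambda>i. 0 :: 'a) = lincomb (\<lambda>_. 0) {}"
    by (simp add: lincomb_def zero_vec_def)
  then have "vec n (\<lambda>i. 0 :: 'a) \<in> span T"
    by (rule in_spanI) simp_all
  then show ?case by simp
next
  case (insert k K)
  have k: "f k \<in> span T" by (rule insert.prems) simp
  then have "dim_vec (f k) = n"
    using span_is_subset2[of T] insert.prems(1) by auto
  then have "vec n (\<lambda>i. \<Sum>k\<in>insert k K. c k * f k $ i)
      = c k \<cdot>\<^sub>v f k + vec n (\<lambda>i. \<Sum>k\<in>K. c k * f k $ i)"
    using insert.hyps by (intro eq_vecI) auto
  also have "\<dots> \<in> span T"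
    using insert k by (intro span_add1 smult_in_span) auto
  finally show ?case .
qed

text \<open>Dividing the relation by \<open>c j\<close> solves it for column \<open>j\<close>.
  Columns with coefficient zero drop out, so membership in the span is asked only of the
  rest.\<close>

lemma col_in_span:
  assumes A: "A \<in> carrier_mat n nc" and T: "T \<subseteq> carrier_vec n"
    and j: "j < nc" "c j \<noteq> 0"
    and ker: "\<And>i. i < n \<Longrightarrow> (\<Sum>k<nc. c k * A $$ (i, k)) = 0"
    and others: "\<And>k. k < nc \<Longrightarrow> k \<noteq> j \<Longrightarrow> c k \<noteq> 0 \<Longrightarrow> col A k \<in> span T"
  shows "col A j \<in> span T"
proof -
  define K where "K = {k. k < nc \<and> k \<noteq> j \<and> c k \<noteq> 0}"
  have "vec n (\<lambda>i. \<Sum>k\<in>K. (- c k / c j) * col A k $ i) \<in> span T"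
    using T others by (intro linear_combination_in_span) (auto simp: K_def)
  also have "vec n (\<lambda>i. \<Sum>k\<in>K. (- c k / c j) * col A k $ i) = col A j"
  proof (rule eq_vecI)
    fix i assume "i < dim_vec (col A j)"
    then have i: "i < n" using A by auto
    have "0 = (\<Sum>k\<in>insert j K. c k * A $$ (i, k))"
      unfolding ker[OF i, symmetric] using j by (intro sum.mono_neutral_right) (auto simp: K_def)
    also have "\<dots> = c j * A $$ (i, j) + (\<Sum>k\<in>K. c k * A $$ (i, k))"
      by (subst sum.insert) (auto simp: K_def)
    finally have "A $$ (i, j) = - (\<Sum>k\<in>K. c k * A $$ (i, k)) / c j"
      using j by (simp add: field_simps eq_neg_iff_add_eq_0)
    also have "\<dots> = (\<Sum>k\<in>K. (- c k / c j) * A $$ (i, k))"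
      by (simp add: sum_negf sum_divide_distrib)
    also have "\<dots> = (\<Sum>k\<in>K. (- c k / c j) * col A k $ i)"
      using A i by (intro sum.cong) (auto simp: K_def)
    finally show "vec n (\<lambda>i. \<Sum>k\<in>K. (- c k / c j) * col A k $ i) $ i = col A j $ i"
      using i j A by auto
  qed (use A in auto)
  finally show ?thesis .
qed

text \<open>The all-ones vector and the nonconstant \<open>b\<close> are independent kernel vectors;
  together they make columns \<open>i\<close> and \<open>j\<close> redundant.\<close>

lemma rank_le_of_kernel:
  assumes A: "A \<in> carrier_mat n nc" and ij: "i < nc" "j < nc" "b i \<noteq> b j"
    and ker1: "\<And>r. r < n \<Longrightarrow> (\<Sum>k<nc. A $$ (r, k)) = 0"
    and kerb: "\<And>r. r < n \<Longrightarrow> (\<Sum>k<nc. b k * A $$ (r, k)) = 0"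
  shows "rank A + 2 \<le> nc"
proof -
  define K where "K = {..<nc} - {i, j}"
  define T where "T = col A ` K"
  have T: "T \<subseteq> carrier_vec n" "finite T"
    using A by (auto simp: T_def K_def)
  have own: "col A k \<in> span T" if "k < nc" "k \<noteq> i" "k \<noteq> j" for k
    using that in_own_span[of T] T(1) by (auto simp: T_def K_def)
  have j: "col A j \<in> span T"
  \<comment> \<open>Subtracting \<open>b i\<close> times the all-ones relation from the relation for
    \<open>b\<close> kills the coefficient of column \<open>i\<close>, whose membership is still
    open, and leaves \<open>b j - b i \<noteq> 0\<close> at column \<open>j\<close>.\<close>
  proof (rule col_in_span[OF A T(1), where c = "\<lambda>k. b k - b i"])
    fix r assume "r < n"
    then show "(\<Sum>k<nc. (b k - b i) * A $$ (r, k)) = 0"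
      using ker1[of r] kerb[of r]
      by (simp add: left_diff_distrib sum_subtractf sum_distrib_left[symmetric])
  qed (use ij own in auto)
  have i: "col A i \<in> span T"
  \<comment> \<open>With column \<open>j\<close> settled, the all-ones relation can be solved for
    column \<open>i\<close>.\<close>
  proof (rule col_in_span[OF A T(1), where c = "\<lambda>_. 1"])
    fix k assume "k < nc" "k \<noteq> i"
    then show "col A k \<in> span T" using own j by (cases "k = j") auto
  qed (use ij ker1 in auto)
  have "col A k \<in> span T" if "k < nc" for k
    using own[OF that] i j by (cases "k = i"; cases "k = j") simp_all
  then have "set (cols A) \<subseteq> span T"
    using A unfolding cols_def by fastforce
  then have "rank A \<le> card T"
    using rank_le_card_spanning[OF A T] by blast
  also have "card T \<le> card K"
    unfolding T_def K_def by (intro card_image_le) auto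
  moreover have ne: "i \<noteq> j" using ij by auto
  then have "card K = nc - 2"
    using ij by (simp add: K_def card_Diff_subset)
  moreover have "nc \<ge> 2" using ij(1,2) ne by arith
  ultimately show ?thesis by auto
qed

end


section \<open>Binomial polynomials\<close>

text \<open>Induction on the roots: each \<open>f x\<close> is a root of \<open>g\<close> or of
  \<open>h\<close>, and its linear factor cancels there. A multiset lets roots repeat.\<close>

lemma split_poly_factor:
  fixes g h :: "'a::field poly"
  assumes "g * h = smult c (\<Prod>x\<in>#M. [:- f x, 1:])" "c \<noteq> 0"
  shows "\<exists>d N. set_mset N \<subseteq> set_mset M \<and> g = smult d (\<Prod>x\<in>#N. [:- f x, 1:])"
  using assms
proof (induction M arbitrary: g h)
  case empty
  then have gh: "g * h = [:c:]" by auto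
  then have "g \<noteq> 0" "h \<noteq> 0" using empty by auto
  then have "degree g = 0" using gh by (metis add_is_0 degree_mult_eq degree_pCons_0)
  then obtain d where "g = [:d:]" by (rule degree_eq_zeroE)
  then show ?case by (intro exI[of _ d] exI[of _ "{#}"]) auto
next
  case (add x M)
  have lin: "[:- f x, 1:] \<noteq> 0" by simp
  have gh: "g * h = [:- f x, 1:] * smult c (\<Prod>x\<in>#M. [:- f x, 1:])"
    using add.prems by simp
  then have "poly g (f x) * poly h (f x) = 0" by (simp flip: poly_mult)
  then consider g' where "g = [:- f x, 1:] * g'" | h' where "h = [:- f x, 1:] * h'"
    unfolding mult_eq_0_iff poly_eq_0_iff_dvd by (auto elim!: dvdE)
  then show ?case
  proof cases
    case 1
    then have "g' * h = smult c (\<Prod>x\<in>#M. [:- f x, 1:])"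
      using gh by (metis (no_types, lifting) lin mult.assoc mult_left_cancel)
    from add.IH[OF this add.prems(2)] obtain d N where
      "set_mset N \<subseteq> set_mset M" "g' = smult d (\<Prod>x\<in>#N. [:- f x, 1:])" by auto
    then show ?thesis using 1
      by (intro exI[of _ d] exI[of _ "add_mset x N"]) auto
  next
    case 2
    then have "g * h' = smult c (\<Prod>x\<in>#M. [:- f x, 1:])"
      using gh by (metis (no_types, lifting) lin mult.left_commute mult_left_cancel)
    from add.IH[OF this add.prems(2)] show ?thesis by auto
  qed
qed

lemma binomial_poly_factor:
  assumes "g * h = binomial_poly n ^ m"
  shows "\<exists>d a. g = smult d (\<Prod>i<n. [:- of_nat i, 1:] ^ a i)"
proof -
  let ?l = "\<lambda>i::nat. [:- of_nat i, 1:] :: rat poly"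
  define M where "M = repeat_mset m (mset_set {..<n})"
  have "(\<Prod>i<n. ?l i) ^ m = (\<Prod>i\<in>#M. ?l i)"
    unfolding M_def by (induction m) (auto simp: prod_unfold_prod_mset)
  then have "g * h = smult ((1 / fact n) ^ m) (\<Prod>i\<in>#M. ?l i)"
    by (simp add: assms binomial_poly_def smult_power)
  from split_poly_factor[OF this] obtain d N
    where N: "set_mset N \<subseteq> set_mset M" "g = smult d (\<Prod>i\<in>#N. ?l i)" by auto
  have "set_mset M \<subseteq> {..<n}"
    unfolding M_def by (induction m) auto
  then have "set_mset N \<subseteq> {..<n}"
    using N(1) by blast
  \<comment> \<open>Multiplicities in \<open>N\<close> become the exponents; indices outside
    \<open>N\<close> get exponent 0, so the product extends to all \<open>i < n\<close>.\<close>
  then have "(\<Prod>i\<in>#N. ?l i) = (\<Prod>i<n. ?l i ^ count N i)"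
    unfolding image_prod_mset_multiplicity
    by (intro prod.mono_neutral_left) (auto simp: not_in_iff)
  then show ?thesis using N(2) by auto
qed

lemma poly_binomial_poly: "poly (binomial_poly n) x = x gchoose n"
  by (simp add: binomial_poly_def gbinomial_prod_rev poly_prod atLeast0LessThan)

lemma poly_binomial_poly_nat: "poly (binomial_poly n) (of_nat k) = of_nat (k choose n)"
  by (simp add: poly_binomial_poly binomial_gbinomial)

lemma binomial_poly_Int_valued: "binomial_poly n \<in> carrier Int_valued"
proof -
  have "(of_int k gchoose n :: rat) \<in> \<int>" for k
  proof (cases "k \<ge> 0")
    case True
    then have "(of_int k gchoose n :: rat) = of_nat (nat k choose n)"
      by (simp add: binomial_gbinomial)
    then show ?thesis by simp
  next
    case False
    \<comment> \<open>For \<open>k < 0\<close> upper negation leads to the top argument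
      \<open>n - k - 1\<close>, which is nonnegative, so \<open>nat\<close> loses nothing.\<close>
    then have eq: "(of_nat n - of_int k - 1 :: rat) = of_nat (nat (int n - k - 1))" by simp
    have "(of_int k gchoose n :: rat) = (- 1) ^ n * (of_nat n - of_int k - 1 gchoose n)"
      by (rule gbinomial_negated_upper)
    also have "\<dots> = (- 1) ^ n * of_nat (nat (int n - k - 1) choose n)"
      by (simp only: eq binomial_gbinomial)
    finally show ?thesis by simp
  qed
  then show ?thesis by (simp add: Int_valued_def poly_binomial_poly)
qed

lemma Int_valued_nat:
  assumes "f \<in> carrier Int_valued"
  obtains z where "poly f (of_nat k) = of_int z"
proof -
  have "poly f (of_int (int k)) \<in> \<int>"
    using assms unfolding Int_valued_def by (simp del: of_int_of_nat_eq)
  then show ?thesis using that by (auto elim!: Ints_cases)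
qed

lemma degree_binomial_poly: "degree (binomial_poly n) = n"
  by (simp add: binomial_poly_def degree_prod_eq_sum_degree)

lemma binomial_poly_nonzero: "binomial_poly n \<noteq> 0"
  by (simp add: binomial_poly_def)


section \<open>The kernel of the valuation matrix\<close>

text \<open>Adding \<open>r\<close> to \<open>n\<close> causes no carry in the last
  base-\<open>p\<close> digit. Raising \<open>r\<close> by one multiplies the binomial coefficient
  by \<open>(n + r + 1) / (r + 1)\<close>, and the residue of \<open>n + r + 1\<close> stays between
  1 and \<open>p - 1\<close>.\<close>

lemma prime_not_dvd_choose:
  fixes p :: nat
  assumes p: "Factorial_Ring.prime p" and "n mod p + r < p"
  shows "\<not> p dvd (n + r) choose n"
  using assms(2)
proof (induction r)
  case 0
  then show ?case using p by auto
next
  case (Suc r)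
  have "(n + Suc r) mod p = n mod p + Suc r"
    using Suc.prems by (metis mod_add_left_eq mod_less)
  then have "\<not> p dvd n + Suc r" by (metis dvd_imp_mod_0 add_is_0 nat.distinct(2))
  moreover have "\<not> p dvd (n + r) choose n" using Suc by auto
  ultimately have "\<not> p dvd (n + Suc r) * ((n + r) choose n)"
    using p by (metis prime_dvd_mult_iff)
  also have "(n + Suc r) * ((n + r) choose n) = Suc r * ((n + Suc r) choose n)"
    using binomial_absorb_comp[of "n + Suc r" n] by simp
  finally show ?case by auto
qed

text \<open>The regular offsets satisfy the no-carry bound; the two exceptional sets are checked by
  computation.\<close>

lemma not_dvd_choose_row_offsets:
  assumes p: "Factorial_Ring.prime p" "p \<le> n" and r: "r \<in> row_offsets n p"
  shows "\<not> p dvd (n + r) choose n"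
proof -
  consider "\<exists>s>1. n = 2 ^ s" "p = 2" | "n = 9" "p = 3" | "1 \<le> r" "r \<le> p - n mod p - 1"
    using r by (auto simp: row_offsets_def split: if_splits)
  then show ?thesis
  proof cases
    case 1
    then obtain s where s: "s > 1" "n = 2 ^ s" by auto
    \<comment> \<open>Since \<open>s > 1\<close>, 4 divides \<open>n\<close>; with
      \<open>n = 4 * q\<close> the two binomial coefficients are \<open>4 * q + 1\<close> and
      \<open>(2 * q + 1) * (4 * q + 1)\<close>, both odd.\<close>
    then have "(2::nat) ^ 2 dvd n" by (metis le_imp_power_dvd Suc_leI Suc_1)
    then obtain q where q: "n = 4 * q" by auto
    have "r \<in> {1, 2}" using r 1 by (auto simp: row_offsets_def)
    moreover have "odd ((n + 1) choose n)" using q by simp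
    moreover have "odd ((n + 2) choose n)"
    proof
      assume "even ((n + 2) choose n)"
      then obtain c where "(n + 2) choose n = 2 * c" by auto
      moreover have "2 * ((n + 2) choose n) = (n + 2) * (n + 1)"
        using binomial_absorb_comp[of "n + 2" n] by simp
      ultimately have "2 * c = (2 * q + 1) * (4 * q + 1)" using q by simp
      then have "even ((2 * q + 1) * (4 * q + 1))" by (metis dvd_triv_left)
      then show False by simp
    qed
    ultimately show ?thesis using 1 by auto
  next
    case 2
    then have "r \<in> {1, 2, 3, 4}" using r by (auto simp: row_offsets_def split: if_splits)
    \<comment> \<open>Each value follows from the previous one by absorption; none is a multiple of
      3.\<close>
    moreover have c: "(10::nat) choose 9 = 10" "(11::nat) choose 9 = 55"
      "(12::nat) choose 9 = 220" "(13::nat) choose 9 = 715"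
      using binomial_absorb_comp[of 10 9] binomial_absorb_comp[of 11 9]
        binomial_absorb_comp[of 12 9] binomial_absorb_comp[of 13 9] by simp_all
    ultimately show ?thesis using 2 by auto
  next
    case 3
    have "n mod p < p" using p prime_gt_0_nat by auto
    with 3 have "n mod p + r < p" by linarith
    then show ?thesis using p by (intro prime_not_dvd_choose)
  qed
qed

text \<open>Taking \<open>p\<close>-adic valuations of \<open>eq\<close> turns products into sums,
  and \<open>z\<close> contributes 0. The entries are nonzero because the convention
  \<open>multiplicity p 0 = 0\<close> breaks additivity.\<close>

lemma sum_multiplicity_eq:
  fixes x y :: "'b \<Rightarrow> nat"
  assumes p: "Factorial_Ring.prime p" and J: "finite J"
    and xy: "\<And>j. j \<in> J \<Longrightarrow> x j \<noteq> 0" "\<And>j. j \<in> J \<Longrightarrow> y j \<noteq> 0"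
    and eq: "z * (\<Prod>j\<in>J. x j ^ a j) = (\<Prod>j\<in>J. y j ^ a j)" and z: "\<not> p dvd z"
  shows "(\<Sum>j\<in>J. int (a j) * (int (multiplicity p (y j)) - int (multiplicity p (x j)))) = 0"
proof -
  have pe: "prime_elem p" using p by (rule prime_imp_prime_elem)
  have m: "multiplicity p (\<Prod>j\<in>J. w j ^ a j) = (\<Sum>j\<in>J. a j * multiplicity p (w j))"
    if "\<And>j. j \<in> J \<Longrightarrow> w j \<noteq> 0" for w :: "'b \<Rightarrow> nat"
  proof -
    have "multiplicity p (\<Prod>j\<in>J. w j ^ a j) = (\<Sum>j\<in>J. multiplicity p (w j ^ a j))"
      by (rule prime_elem_multiplicity_prod_distrib[OF pe _ J]) (use that in force)
    also have "\<dots> = (\<Sum>j\<in>J. a j * multiplicity p (w j))"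
      using that by (intro sum.cong prime_elem_multiplicity_power_distrib pe) auto
    finally show ?thesis .
  qed
  have "z \<noteq> 0" using z by (metis dvd_0_right)
  then have "multiplicity p (z * (\<Prod>j\<in>J. x j ^ a j))
      = multiplicity p z + multiplicity p (\<Prod>j\<in>J. x j ^ a j)"
    using J xy by (intro prime_elem_multiplicity_mult_distrib pe) auto
  then have "(\<Sum>j\<in>J. a j * multiplicity p (y j)) = (\<Sum>j\<in>J. a j * multiplicity p (x j))"
    using z by (simp add: eq m xy not_dvd_imp_multiplicity_0)
  then have "(\<Sum>j\<in>J. int (a j) * int (multiplicity p (y j)))
      = (\<Sum>j\<in>J. int (a j) * int (multiplicity p (x j)))"
    by (metis (mono_tags, lifting) of_nat_mult of_nat_sum sum.cong)
  then show ?thesis by (simp add: right_diff_distrib sum_subtractf)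
qed

lemma dim_valuation_matrix: "dim_col (valuation_matrix n) = n"
  by (simp add: valuation_matrix_def)

lemma exponents_in_kernel:
  assumes g: "g \<in> carrier Int_valued" and h: "h \<in> carrier Int_valued"
    and gh: "g * h = binomial_poly n ^ m"
    and ga: "g = smult d (\<Prod>i<n. [:- of_nat i, 1:] ^ a i)"
    and i: "i < dim_row (valuation_matrix n)"
  shows "(\<Sum>j<n. int (a j) * valuation_matrix n $$ (i, j)) = 0"
proof -
  obtain p r where pr: "row_indices n ! i = (p, r)" by fastforce
  have i': "i < length (row_indices n)" using i by (simp add: valuation_matrix_def)
  then have "(p, r) \<in> set (row_indices n)" using pr by (metis nth_mem)
  then have p: "Factorial_Ring.prime p" "p \<le> n" and r: "r \<in> row_offsets n p"
    by (auto simp: set_row_indices primes_upto_def)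
  \<comment> \<open>At a natural number \<open>k\<close>, \<open>g\<close> takes an integer value
    whose cofactor in the power of \<open>k choose n\<close> is the value of
    \<open>h\<close>.\<close>
  have val: "\<exists>z w. poly g (of_nat k) = of_int z \<and> z * w = int (k choose n) ^ m" for k
  proof -
    obtain z w where zw: "poly g (of_nat k) = of_int z" "poly h (of_nat k) = of_int w"
      using g h by (metis Int_valued_nat)
    have "of_int (z * w) = poly (g * h) (of_nat k)" by (simp add: zw)
    also have "\<dots> = of_int (int (k choose n) ^ m)"
      by (simp add: gh poly_binomial_poly_nat)
    finally show ?thesis using zw by (metis of_int_eq_iff)
  qed
  \<comment> \<open>The bound \<open>n \<le> k\<close> keeps the natural subtraction
    \<open>k - j\<close> exact.\<close>
  have ev: "poly g (of_nat k) = d * of_nat (\<Prod>j<n. (k - j) ^ a j)" if "n \<le> k" for k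
    using that by (auto simp: ga poly_prod of_nat_diff intro!: prod.cong)
  \<comment> \<open>At \<open>n\<close> the binomial coefficient is 1, so the value of
    \<open>g\<close> there is a unit of the integers.\<close>
  obtain e w where e: "poly g (of_nat n) = of_int e" "e * w = 1"
    using val[of n] by auto
  then have "\<bar>e\<bar> = 1" by (metis abs_zmult_eq_1 abs_1)
  obtain z v where z: "poly g (of_nat (n + r)) = of_int z" "z * v = int ((n + r) choose n) ^ m"
    using val[of "n + r"] by auto
  have "\<not> int p dvd z"
  proof
    assume "int p dvd z"
    then have "int p dvd int (((n + r) choose n) ^ m)" using z(2) by (metis dvd_mult2 of_nat_power)
    then have "p dvd (n + r) choose n" using p by (meson int_dvd_int_iff prime_dvd_power)
    then show False using not_dvd_choose_row_offsets[OF p r] by blast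
  qed
  then have z': "\<not> p dvd nat \<bar>z\<bar>" by (simp add: int_dvd_int_iff[symmetric])
  \<comment> \<open>Up to the common rational factor \<open>d\<close>, the values of
    \<open>g\<close> at \<open>n\<close> and \<open>n + r\<close> are \<open>D\<close> and
    \<open>E\<close>. Comparing them eliminates \<open>d\<close> and leaves an identity between
    natural numbers.\<close>
  define D where "D = (\<Prod>j<n. (n - j) ^ a j)"
  define E where "E = (\<Prod>j<n. (n + r - j) ^ a j)"
  have "d * of_nat D = of_int e" "d * of_nat E = of_int z"
    using ev[of n] ev[of "n + r"] e z by (simp_all add: D_def E_def)
  then have "of_int z * of_nat D = (of_int e * of_nat E :: rat)"
    by (metis mult.assoc mult.commute)
  then have "z * int D = e * int E" by (metis of_int_eq_iff of_int_mult of_int_of_nat_eq)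
  then have "\<bar>z\<bar> * int D = int E"
    using \<open>\<bar>e\<bar> = 1\<close> by (metis abs_mult abs_of_nat mult_1)
  then have "nat \<bar>z\<bar> * D = E" by (metis abs_ge_zero int_nat_eq nat_int of_nat_mult)
  from sum_multiplicity_eq[OF p(1) _ _ _ this[unfolded D_def E_def] z']
  have "(\<Sum>j<n. int (a j) * (int (multiplicity p (n + r - j)) - int (multiplicity p (n - j)))) = 0"
    by auto
  then show ?thesis
    using i' by (simp add: valuation_matrix_def pr)
qed

text \<open>Two different exponents would make \<open>a\<close> independent of the all-ones vector
  inside the kernel, pushing the rank down to at most \<open>n - 2\<close>.\<close>

lemma constant_exponents:
  assumes n: "n \<ge> 2" and rank: "rank_over_rat (valuation_matrix n) = n - 1"
    and g: "g \<in> carrier Int_valued" and h: "h \<in> carrier Int_valued"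
    and gh: "g * h = binomial_poly n ^ m"
    and ga: "g = smult d (\<Prod>i<n. [:- of_nat i, 1:] ^ a i)"
    and ij: "i < n" "j < n"
  shows "a i = a j"
proof (rule ccontr)
  assume neq: "a i \<noteq> a j"
  define A where "A = map_mat rat_of_int (valuation_matrix n)"
  have A: "A \<in> carrier_mat (dim_row (valuation_matrix n)) n"
    by (intro carrier_matI) (simp_all add: A_def dim_valuation_matrix)
  have ker: "(\<Sum>k<n. of_nat (c k) * A $$ (r, k)) = 0"
    if "(\<Sum>k<n. int (c k) * valuation_matrix n $$ (r, k)) = 0" "r < dim_row (valuation_matrix n)"
    for r c
  proof -
    have "(\<Sum>k<n. of_nat (c k) * A $$ (r, k))
        = of_int (\<Sum>k<n. int (c k) * valuation_matrix n $$ (r, k))"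
      using that(2) by (simp add: A_def dim_valuation_matrix)
    then show ?thesis using that(1) by simp
  qed
  have one: "(1 :: rat poly) \<in> carrier Int_valued"
    by (simp add: Int_valued_def)
  \<comment> \<open>The binomial polynomial divides its own first power with cofactor 1, and all its
    exponents are 1; this puts the all-ones vector into the kernel.\<close>
  have "binomial_poly n = smult (1 / fact n) (\<Prod>i<n. [:- of_nat i, 1:] ^ 1)"
    by (simp add: binomial_poly_def)
  from exponents_in_kernel[OF binomial_poly_Int_valued one _ this, of 1]
  have "(\<Sum>k<n. of_nat 1 * A $$ (r, k)) = 0" if "r < dim_row (valuation_matrix n)" for r
    using that by (intro ker) auto
  moreover have "(\<Sum>k<n. of_nat (a k) * A $$ (r, k)) = 0"
    if "r < dim_row (valuation_matrix n)" for r
    using that by (intro ker exponents_in_kernel[OF g h gh ga])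
  ultimately have "vec_space.rank (dim_row (valuation_matrix n)) A + 2 \<le> n"
    using neq by (intro vec_space.rank_le_of_kernel[OF A ij, where b = "\<lambda>k. of_nat (a k)"]) auto
  then show False
    using n rank by (simp add: rank_over_rat_def A_def)
qed

text \<open>With constant exponents \<open>g\<close> is a scalar multiple of a power of the binomial
  polynomial. That power has value 1 at \<open>n\<close>, so the scalar is the value of
  \<open>g\<close> there, an integer dividing 1.\<close>

lemma binomial_poly_power_divisor:
  assumes n: "n \<ge> 2" and rank: "rank_over_rat (valuation_matrix n) = n - 1"
    and g: "g \<in> carrier Int_valued" and h: "h \<in> carrier Int_valued"
    and gh: "g * h = binomial_poly n ^ m"
  shows "\<exists>t. g = binomial_poly n ^ t \<or> g = - (binomial_poly n ^ t)"
proof -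
  obtain d a where ga: "g = smult d (\<Prod>i<n. [:- of_nat i, 1:] ^ a i)"
    using binomial_poly_factor[OF gh] by blast
  define t where "t = a 0"
  have "a i = t" if "i < n" for i
    unfolding t_def using n that by (intro constant_exponents[OF n rank g h gh ga]) auto
  then have "g = smult d ((\<Prod>i<n. [:- of_nat i, 1:]) ^ t)"
    by (simp add: ga prod_power_distrib)
  also have "\<dots> = smult (d * fact n ^ t) (binomial_poly n ^ t)"
    by (simp add: binomial_poly_def smult_power power_divide)
  finally have gt: "g = smult (d * fact n ^ t) (binomial_poly n ^ t)" .
  obtain e w where ew: "poly g (of_nat n) = of_int e" "poly h (of_nat n) = of_int w"
    using g h by (metis Int_valued_nat)
  have "of_int (e * w) = poly (g * h) (of_nat n)" by (simp add: ew)
  also have "\<dots> = 1" by (simp add: gh poly_binomial_poly_nat)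
  finally have "e * w = 1" by (metis of_int_eq_1_iff)
  then have "e = 1 \<or> e = - 1" by (auto simp: zmult_eq_1_iff)
  moreover have "d * fact n ^ t = of_int e"
    using ew(1) by (simp add: gt poly_binomial_poly_nat)
  ultimately have "d * fact n ^ t = 1 \<or> d * fact n ^ t = - 1" by auto
  then show ?thesis by (auto simp: gt)
qed


section \<open>Absolute irreducibility\<close>

theorem proposition3p15:
  fixes n :: nat
  assumes "n \<ge> 2"
    and "rank_over_rat (valuation_matrix n) = n - 1"
  shows "absolutely_irreducible Int_valued (binomial_poly n)"
proof -
  define b where "b = binomial_poly n"
  interpret D: domain Int_valued by (rule domain_Int_valued)
  have ops: "mult Int_valued = (*)" "one Int_valued = 1" "zero Int_valued = 0"
    by (simp_all add: Int_valued_def)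
  have neg: "- f \<in> carrier Int_valued" if "f \<in> carrier Int_valued" for f
    using that by (simp add: Int_valued_def)
  have pow: "f [^]\<^bsub>Int_valued\<^esub> k = f ^ k" for f and k :: nat
    by (induction k) (simp_all add: ops mult.commute)
  have b: "b \<in> carrier Int_valued"
    by (simp add: b_def binomial_poly_Int_valued)
  have bpow: "b ^ k \<in> carrier Int_valued" for k
    using D.nat_pow_closed[OF b, of k] by (simp add: pow)
  have b0: "b \<noteq> 0" and deg: "degree b = n"
    by (simp_all add: b_def binomial_poly_nonzero degree_binomial_poly)
  have degpow: "degree (b ^ k) = k * n" for k
    by (simp add: degree_power_eq b0 deg)
  have sign_unit: "1 \<in> Units Int_valued" "- 1 \<in> Units Int_valued"
    using D.one_closed neg[OF D.one_closed] by (auto simp: Units_def ops)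
  have assoc: "f \<sim>\<^bsub>Int_valued\<^esub> g"
    if "f \<in> {b, - b}" "g \<in> {b, - b}" for f g
  proof -
    have "f' divides\<^bsub>Int_valued\<^esub> g'" if "f' \<in> {b, - b}" "g' \<in> {b, - b}" for f' g'
    proof -
      have "g' = f' * 1 \<or> g' = f' * - 1" using that by auto
      then obtain u where "u \<in> Units Int_valued" "g' = f' * u" using sign_unit by blast
      then show ?thesis
        using D.Units_closed by (auto simp: factor_def ops)
    qed
    then show ?thesis using that by (simp add: associated_def)
  qed
  have bdiv: "b divides\<^bsub>Int_valued\<^esub> g" if "g = b ^ Suc k \<or> g = - (b ^ Suc k)" for g k
  proof -
    have "g = b * b ^ k \<or> g = b * - (b ^ k)" using that by auto
    then obtain c where "c \<in> carrier Int_valued" "g = b * c"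
      using bpow neg by blast
    then show ?thesis by (auto simp: factor_def ops)
  qed
  have b_unit: "b \<notin> Units Int_valued"
  proof
    assume "b \<in> Units Int_valued"
    then obtain c where "b * c = 1" by (auto simp: Units_def ops)
    then have "degree b = 0"
      by (metis add_is_0 degree_1 degree_mult_eq mult_zero_right zero_neq_one b0)
    then show False using deg assms(1) by simp
  qed
  have divisor: "\<exists>t. g = b ^ t \<or> g = - (b ^ t)"
    if g: "g \<in> carrier Int_valued" "g divides\<^bsub>Int_valued\<^esub> (b ^ m)" for g m
  proof -
    obtain h where "h \<in> carrier Int_valued" "g * h = b ^ m"
      using g(2) by (auto simp: factor_def ops)
    then show ?thesis
      using binomial_poly_power_divisor[OF assms g(1)] unfolding b_def by blast
  qed
  have irr: "Divisibility.irreducible Int_valued b"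
    unfolding Divisibility.irreducible_def
  proof (intro conjI ballI impI b_unit)
    fix g assume g: "g \<in> carrier Int_valued" "properfactor Int_valued g b"
    then have "g divides\<^bsub>Int_valued\<^esub> (b ^ 1)" by (simp add: properfactor_def)
    from divisor[OF g(1) this] obtain t where t: "g = b ^ t \<or> g = - (b ^ t)" by blast
    show "g \<in> Units Int_valued"
    \<comment> \<open>Exponent 0 gives the unit 1 or -1; a positive exponent makes \<open>b\<close>
      divide \<open>g\<close>, against properness.\<close>
    proof (cases t)
      case 0
      then show ?thesis using t sign_unit by auto
    next
      case (Suc k)
      then show ?thesis using bdiv t g(2) by (auto simp: properfactor_def)
    qed
  qed
  have irr_divisor: "g \<in> {b, - b}"
    if g: "g \<in> carrier Int_valued" "Divisibility.irreducible Int_valued g"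
      "g divides\<^bsub>Int_valued\<^esub> (b ^ m)" for g m
  proof -
    obtain t where t: "g = b ^ t \<or> g = - (b ^ t)" using divisor[OF g(1,3)] by blast
    moreover have "g \<notin> Units Int_valued" using g(2) by (simp add: Divisibility.irreducible_def)
    ultimately have "t \<noteq> 0" using sign_unit by (metis power_0)
    then obtain k where k: "t = Suc k" by (cases t) auto
    \<comment> \<open>The nonunit \<open>b\<close> cannot be a proper factor of the irreducible
      \<open>g\<close>, so \<open>g\<close> divides \<open>b\<close> in turn, and degrees force
      \<open>t = 1\<close>.\<close>
    have "b divides\<^bsub>Int_valued\<^esub> g" using bdiv t k by blast
    then have "g divides\<^bsub>Int_valued\<^esub> b"
      using g(2) b b_unit by (auto simp: Divisibility.irreducible_def properfactor_def)
    then obtain c where "b = g * c" by (auto simp: factor_def ops)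
    then have "degree g \<le> n"
      using b0 deg by (metis dvdI dvd_imp_degree_le)
    then have "t * n \<le> n" using t degpow[of t] by auto
    then have "t = 1" using k assms(1) by auto
    then show ?thesis using t by auto
  qed
  have factors: "set fs \<subseteq> {b, - b} \<and> length fs = m"
    if fs: "set fs \<subseteq> carrier Int_valued" "factors Int_valued fs (b ^ m)" for fs m
  proof -
    have sub: "set fs \<subseteq> {b, - b}"
    proof
      fix g assume "g \<in> set fs"
      moreover from this have "g divides\<^bsub>Int_valued\<^esub> (b ^ m)"
        using D.multlist_dividesI[OF _ fs(1)] fs(2) by (auto simp: factors_def)
      ultimately show "g \<in> {b, - b}"
        using fs by (intro irr_divisor) (auto simp: factors_def)
    qed
    \<comment> \<open>A product of copies of \<open>b\<close> and \<open>- b\<close> is a power of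
      \<open>b\<close> up to sign; since \<open>n > 0\<close>, its degree determines the number of
      factors.\<close>
    then have "foldr (*) fs 1 = b ^ length fs \<or> foldr (*) fs 1 = - (b ^ length fs)"
      by (induction fs) auto
    then have "degree (b ^ m) = degree (b ^ length fs)"
      using fs(2) by (auto simp: factors_def ops)
    then show ?thesis using sub assms(1) by (simp add: degpow)
  qed
  have "factors_uniquely Int_valued (b ^ m)" for m
    unfolding factors_uniquely_def
  proof (intro conjI allI impI)
    have "foldr (*) (replicate m b) 1 = b ^ m" by (induction m) auto
    then show "\<exists>fs. set fs \<subseteq> carrier Int_valued \<and> factors Int_valued fs (b ^ m)"
      using b irr by (intro exI[of _ "replicate m b"]) (auto simp: factors_def ops)
  next
    fix fs gs
    assume "set fs \<subseteq> carrier Int_valued" "set gs \<subseteq> carrier Int_valued"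
      "factors Int_valued fs (b ^ m)" "factors Int_valued gs (b ^ m)"
    then have "set fs \<subseteq> {b, - b}" "set gs \<subseteq> {b, - b}" "length fs = length gs"
      using factors by metis+
    \<comment> \<open>All entries are associates of one another, so lists of equal length match
      position by position in the given order.\<close>
    then have "list_all2 (associated Int_valued) fs gs"
      by (intro list_all2_all_nthI assoc) (metis nth_mem subsetD)+
    then show "essentially_equal Int_valued fs gs"
      by (auto simp: essentially_equal_def)
  qed
  then show ?thesis
    using b b0 irr by (simp add: absolutely_irreducible_def ring_irreducible_def ops pow flip: b_def)
qed

end
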